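(* Let $G$ be a group, and let $\varphi\colon G\times G\to K(G)$ be the map $\varphi(a,b)=e_{ab}^{-1}e_ae_b$. Then $\varphi$ is a symmetric equivariant group $2$-cocycle. That is, for all $a,b,c\in G$ (writing $K(G)$ additively): $$\varphi(b,c)-\varphi(ab,c)+\varphi(a,bc)-\varphi(a,b)=0,$$ $$\varphi(a,1)=e_1,$$ $$\varphi(c^{-1}ac,\,c^{-1}bc)=\varphi(a,b),$$ $$\varphi(a,b)=\varphi(b,a).$$
   Context: For a group $G$, $A(G)=\langle e_a,\ a\in G\mid e_ae_b=e_be_{b^{-1}ab},\ a,b\in G\rangle$, $\pi\colon A(G)\to G$ is the homomorphism $e_a\mapsto a$, and $K(G):=\operatorname{Ker}(\pi)$, which is a central (hence abelian) subgroup of $A(G)$. *)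

theory Defs
  imports "HOL-Algebra.Coset"
begin

section \<open>Groups given by generators and relations\<close>

text \<open>A word is a list of signed letters: (True, x) stands for x, and (False, x) for the
  formal inverse of x. A relation u = v is a pair of words (u, v).\<close>

type_synonym 'a gword = "(bool \<times> 'a) list"

definition gwords :: "'a set \<Rightarrow> 'a gword set" where
  "gwords X = lists (UNIV \<times> X)"

inductive pres_cong :: "'a set \<Rightarrow> ('a gword \<times> 'a gword) set \<Rightarrow> 'a gword \<Rightarrow> 'a gword \<Rightarrow> bool"
  for X :: "'a set" and R :: "('a gword \<times> 'a gword) set" where
  refl: "w \<in> gwords X \<Longrightarrow> pres_cong X R w w"
| sym: "pres_cong X R u v \<Longrightarrow> pres_cong X R v u"
| trans: "pres_cong X R u v \<Longrightarrow> pres_cong X R v w \<Longrightarrow> pres_cong X R u w"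
| append: "pres_cong X R u u' \<Longrightarrow> pres_cong X R v v' \<Longrightarrow> pres_cong X R (u @ v) (u' @ v')"
| cancel: "x \<in> X \<Longrightarrow> pres_cong X R [(s, x), (\<not> s, x)] []"
| rel: "(u, v) \<in> R \<Longrightarrow> u \<in> gwords X \<Longrightarrow> v \<in> gwords X \<Longrightarrow> pres_cong X R u v"

definition pres_class :: "'a set \<Rightarrow> ('a gword \<times> 'a gword) set \<Rightarrow> 'a gword \<Rightarrow> 'a gword set" where
  "pres_class X R w = {v. pres_cong X R w v}"

definition presented_group ::
    "'a set \<Rightarrow> ('a gword \<times> 'a gword) set \<Rightarrow> 'a gword set monoid" where
  "presented_group X R =
     \<lparr>carrier = pres_class X R ` gwords X,
      mult = (\<lambda>C D. \<Union>u\<in>C. \<Union>v\<in>D. pres_class X R (u @ v)),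
      one = pres_class X R []\<rparr>"

fun word_eval :: "('b, 'm) monoid_scheme \<Rightarrow> ('a \<Rightarrow> 'b) \<Rightarrow> 'a gword \<Rightarrow> 'b" where
  "word_eval H f [] = \<one>\<^bsub>H\<^esub>"
| "word_eval H f ((s, x) # w) = (if s then f x else inv\<^bsub>H\<^esub> f x) \<otimes>\<^bsub>H\<^esub> word_eval H f w"

text \<open>The homomorphism out of a presented group extending a map f on the generators;
  meaningful when f respects the relations, since evaluation is then constant on each class.\<close>

definition pres_lift :: "('b, 'm) monoid_scheme \<Rightarrow> ('a \<Rightarrow> 'b) \<Rightarrow> 'a gword set \<Rightarrow> 'b" where
  "pres_lift H f C = the_elem (word_eval H f ` C)"

lemma pres_cong_gwords: "pres_cong X R u v \<Longrightarrow> u \<in> gwords X \<and> v \<in> gwords X"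
  by (induction rule: pres_cong.induct) (auto simp: gwords_def)

lemma pres_class_eq_iff:
  assumes "v \<in> gwords X"
  shows "pres_class X R u = pres_class X R v \<longleftrightarrow> pres_cong X R u v"
proof
  assume "pres_class X R u = pres_class X R v"
  then show "pres_cong X R u v"
    using pres_cong.refl[OF assms, of R] unfolding pres_class_def by blast
next
  assume uv: "pres_cong X R u v"
  have "pres_cong X R u w \<longleftrightarrow> pres_cong X R v w" for w
    using uv pres_cong.sym pres_cong.trans by metis
  then show "pres_class X R u = pres_class X R v"
    by (simp add: pres_class_def)
qed

lemma pres_class_self: "u \<in> gwords X \<Longrightarrow> u \<in> pres_class X R u"
  by (simp add: pres_class_def pres_cong.refl)

lemma presented_group_mult:
  assumes "u \<in> gwords X" "v \<in> gwords X"
  shows "pres_class X R u \<otimes>\<^bsub>presented_group X R\<^esub> pres_class X R v = pres_class X R (u @ v)"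
proof -
  have "pres_class X R (u' @ v') = pres_class X R (u @ v)"
    if "u' \<in> pres_class X R u" "v' \<in> pres_class X R v" for u' v'
  proof -
    have "pres_cong X R (u @ v) (u' @ v')"
      using that by (auto simp: pres_class_def intro: pres_cong.append)
    then show ?thesis
      using pres_class_eq_iff pres_cong_gwords by metis
  qed
  then have "(\<Union>u'\<in>pres_class X R u. \<Union>v'\<in>pres_class X R v. pres_class X R (u' @ v'))
      = (\<Union>u'\<in>pres_class X R u. \<Union>v'\<in>pres_class X R v. pres_class X R (u @ v))"
    by (intro SUP_cong) auto
  also have "\<dots> = pres_class X R (u @ v)"
    using pres_class_self[OF assms(1), of R] pres_class_self[OF assms(2), of R] by blast
  finally show ?thesis
    by (simp add: presented_group_def)
qed

lemma gwords_append: "u \<in> gwords X \<Longrightarrow> v \<in> gwords X \<Longrightarrow> u @ v \<in> gwords X"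
  by (auto simp: gwords_def)

lemma gwords_Nil: "[] \<in> gwords X"
  by (auto simp: gwords_def)

lemma pres_cong_inverse:
  assumes "w \<in> gwords X"
  shows "\<exists>v\<in>gwords X. pres_cong X R (v @ w) []"
  using assms
proof (induction w)
  case Nil
  then show ?case
    by (intro bexI[of _ "[]"]) (auto simp: gwords_Nil intro: pres_cong.refl)
next
  case (Cons p w)
  obtain s x where p: "p = (s, x)" by (cases p)
  have x: "x \<in> X" and w: "w \<in> gwords X" using Cons.prems p by (auto simp: gwords_def)
  obtain v where v: "v \<in> gwords X" "pres_cong X R (v @ w) []" using Cons.IH w by blast
  have "pres_cong X R ([(\<not> s, x), (s, x)]) []" using pres_cong.cancel[OF x, of R "\<not> s"] by simp
  then have "pres_cong X R ([(\<not> s, x), (s, x)] @ w) ([] @ w)"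
    by (rule pres_cong.append) (rule pres_cong.refl[OF w])
  then have "pres_cong X R (v @ [(\<not> s, x), (s, x)] @ w) (v @ [] @ w)"
    by (rule pres_cong.append[OF pres_cong.refl[OF v(1)]])
  then have "pres_cong X R ((v @ [(\<not> s, x)]) @ (p # w)) []"
    using pres_cong.trans[OF _ v(2)] p by simp
  moreover have "v @ [(\<not> s, x)] \<in> gwords X" using v x by (auto simp: gwords_def)
  ultimately show ?case by blast
qed

lemma carrier_presented_group: "carrier (presented_group X R) = pres_class X R ` gwords X"
  by (simp add: presented_group_def)

lemma one_presented_group: "\<one>\<^bsub>presented_group X R\<^esub> = pres_class X R []"
  by (simp add: presented_group_def)

theorem group_presented_group: "group (presented_group X R)"
proof (rule groupI)
  fix C assume "C \<in> carrier (presented_group X R)"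
  then obtain w where w: "w \<in> gwords X" "C = pres_class X R w"
    by (auto simp: carrier_presented_group)
  then obtain v where v: "v \<in> gwords X" "pres_cong X R (v @ w) []"
    using pres_cong_inverse by blast
  show "\<exists>D\<in>carrier (presented_group X R). D \<otimes>\<^bsub>presented_group X R\<^esub> C = \<one>\<^bsub>presented_group X R\<^esub>"
  proof (rule bexI)
    show "pres_class X R v \<otimes>\<^bsub>presented_group X R\<^esub> C = \<one>\<^bsub>presented_group X R\<^esub>"
      using v w by (simp add: presented_group_mult one_presented_group pres_class_eq_iff gwords_append
          gwords_Nil)
    show "pres_class X R v \<in> carrier (presented_group X R)"
      using v by (simp add: carrier_presented_group)
  qed
qed (auto simp: carrier_presented_group one_presented_group presented_group_mult
      gwords_append gwords_Nil)

lemma word_eval_closed: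
  assumes "group H" "f \<in> X \<rightarrow> carrier H" "w \<in> gwords X"
  shows "word_eval H f w \<in> carrier H"
proof -
  interpret group H by fact
  show ?thesis using assms(2,3) by (induction w) (auto simp: gwords_def Pi_iff)
qed

lemma word_eval_append:
  assumes "group H" "f \<in> X \<rightarrow> carrier H" "u \<in> gwords X" "v \<in> gwords X"
  shows "word_eval H f (u @ v) = word_eval H f u \<otimes>\<^bsub>H\<^esub> word_eval H f v"
proof -
  interpret group H by fact
  have v: "word_eval H f v \<in> carrier H" using word_eval_closed assms by blast
  show ?thesis using assms(3)
  proof (induction u)
    case Nil
    then show ?case using v by simp
  next
    case (Cons p u)
    obtain s x where p: "p = (s, x)" by (cases p)
    have "f x \<in> carrier H" "u \<in> gwords X"
      using Cons.prems p assms(2) by (auto simp: gwords_def)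
    then show ?case
      using Cons.IH v p word_eval_closed[OF assms(1,2), of u] by (simp add: m_assoc)
  qed
qed

lemma word_eval_cong:
  assumes "group H" "f \<in> X \<rightarrow> carrier H"
    and "\<And>u v. (u, v) \<in> R \<Longrightarrow> word_eval H f u = word_eval H f v"
    and "pres_cong X R u v"
  shows "word_eval H f u = word_eval H f v"
proof -
  interpret group H by fact
  show ?thesis using assms(4)
  proof (induction rule: pres_cong.induct)
    case (append u u' v v')
    then show ?case
      using word_eval_append[OF assms(1,2)] pres_cong_gwords by metis
  next
    case (cancel x s)
    then have "f x \<in> carrier H" using assms(2) by auto
    then show ?case by simp
  next
    case (rel u v)
    then show ?case using assms(3) by blast
  qed simp_all
qed

lemma pres_lift_class:
  assumes "group H" "f \<in> X \<rightarrow> carrier H"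
    and "\<And>u v. (u, v) \<in> R \<Longrightarrow> word_eval H f u = word_eval H f v"
    and "w \<in> gwords X"
  shows "pres_lift H f (pres_class X R w) = word_eval H f w"
proof -
  have "word_eval H f ` pres_class X R w = {word_eval H f w}"
    using word_eval_cong[OF assms(1-3)] pres_class_self[OF assms(4)]
    by (fastforce simp: pres_class_def)
  then show ?thesis by (simp add: pres_lift_def)
qed

theorem pres_lift_hom:
  assumes "group H" "f \<in> X \<rightarrow> carrier H"
    and "\<And>u v. (u, v) \<in> R \<Longrightarrow> word_eval H f u = word_eval H f v"
  shows "pres_lift H f \<in> hom (presented_group X R) H"
  by (rule homI)
    (auto simp: carrier_presented_group presented_group_mult pres_lift_class[OF assms]
      gwords_append word_eval_closed[OF assms(1,2)] word_eval_append[OF assms(1,2)])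


section \<open>The group A(G) and the central subgroup K(G)\<close>

definition conj_relations :: "('a, 'm) monoid_scheme \<Rightarrow> ('a gword \<times> 'a gword) set" where
  "conj_relations G =
     {([(True, a), (True, b)], [(True, b), (True, inv\<^bsub>G\<^esub> b \<otimes>\<^bsub>G\<^esub> a \<otimes>\<^bsub>G\<^esub> b)]) | a b.
        a \<in> carrier G \<and> b \<in> carrier G}"

definition A_grp :: "('a, 'm) monoid_scheme \<Rightarrow> 'a gword set monoid" where
  "A_grp G = presented_group (carrier G) (conj_relations G)"

definition e_gen :: "('a, 'm) monoid_scheme \<Rightarrow> 'a \<Rightarrow> 'a gword set" where
  "e_gen G a = pres_class (carrier G) (conj_relations G) [(True, a)]"

definition A_proj :: "('a, 'm) monoid_scheme \<Rightarrow> 'a gword set \<Rightarrow> 'a" where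
  "A_proj G = pres_lift G (\<lambda>a. a)"

definition K_grp :: "('a, 'm) monoid_scheme \<Rightarrow> 'a gword set monoid" where
  "K_grp G = (A_grp G)\<lparr>carrier := kernel (A_grp G) G (A_proj G)\<rparr>"

definition phi :: "('a, 'm) monoid_scheme \<Rightarrow> 'a \<Rightarrow> 'a \<Rightarrow> 'a gword set" where
  "phi G a b =
     inv\<^bsub>A_grp G\<^esub> (e_gen G (a \<otimes>\<^bsub>G\<^esub> b)) \<otimes>\<^bsub>A_grp G\<^esub> e_gen G a \<otimes>\<^bsub>A_grp G\<^esub> e_gen G b"

lemma group_A_grp: "group (A_grp G)"
  by (simp add: A_grp_def group_presented_group)

lemma e_gen_closed: "a \<in> carrier G \<Longrightarrow> e_gen G a \<in> carrier (A_grp G)"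
  by (auto simp: e_gen_def A_grp_def carrier_presented_group gwords_def)

lemma e_gen_relation:
  assumes "group G" "a \<in> carrier G" "b \<in> carrier G"
  shows "e_gen G a \<otimes>\<^bsub>A_grp G\<^esub> e_gen G b
    = e_gen G b \<otimes>\<^bsub>A_grp G\<^esub> e_gen G (inv\<^bsub>G\<^esub> b \<otimes>\<^bsub>G\<^esub> a \<otimes>\<^bsub>G\<^esub> b)"
proof -
  interpret group G by fact
  have "pres_cong (carrier G) (conj_relations G)
      [(True, a), (True, b)] [(True, b), (True, inv\<^bsub>G\<^esub> b \<otimes>\<^bsub>G\<^esub> a \<otimes>\<^bsub>G\<^esub> b)]"
    using assms by (intro pres_cong.rel) (auto simp: conj_relations_def gwords_def)
  then show ?thesis
    using assms
    by (simp add: e_gen_def A_grp_def presented_group_mult gwords_def pres_class_eq_iff)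
qed

lemma conj_relations_respected:
  assumes "group G" "(u, v) \<in> conj_relations G"
  shows "word_eval G (\<lambda>a. a) u = word_eval G (\<lambda>a. a) v"
proof -
  interpret group G by fact
  show ?thesis using assms(2) by (auto simp: conj_relations_def m_assoc[symmetric])
qed

lemma A_proj_hom: "group G \<Longrightarrow> A_proj G \<in> hom (A_grp G) G"
  unfolding A_proj_def A_grp_def
  by (rule pres_lift_hom) (auto intro: conj_relations_respected)

lemma A_proj_e_gen:
  assumes "group G" "a \<in> carrier G"
  shows "A_proj G (e_gen G a) = a"
proof -
  interpret group G by fact
  have "pres_lift G (\<lambda>a. a) (pres_class (carrier G) (conj_relations G) [(True, a)])
      = word_eval G (\<lambda>a. a) [(True, a)]"
    using assms by (intro pres_lift_class) (auto intro: conj_relations_respected simp: gwords_def)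
  then show ?thesis using assms by (simp add: A_proj_def e_gen_def)
qed

lemma group_hom_A_proj: "group G \<Longrightarrow> group_hom (A_grp G) G (A_proj G)"
  by (simp add: group_hom_def group_hom_axioms_def group_A_grp A_proj_hom)

lemma group_K_grp: "group G \<Longrightarrow> group (K_grp G)"
  unfolding K_grp_def
  by (intro group.subgroup_imp_group group_A_grp group_hom.subgroup_kernel group_hom_A_proj)

lemma A_grp_induct [consumes 1, case_names one gen inv_gen]:
  assumes "x \<in> carrier (A_grp G)"
    and "P \<one>\<^bsub>A_grp G\<^esub>"
    and gen: "\<And>b y. b \<in> carrier G \<Longrightarrow> y \<in> carrier (A_grp G) \<Longrightarrow> P y \<Longrightarrow> P (e_gen G b \<otimes>\<^bsub>A_grp G\<^esub> y)"
    and inv_gen: "\<And>b y. b \<in> carrier G \<Longrightarrow> y \<in> carrier (A_grp G) \<Longrightarrow> P y \<Longrightarrow>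
      P (inv\<^bsub>A_grp G\<^esub> (e_gen G b) \<otimes>\<^bsub>A_grp G\<^esub> y)"
  shows "P x"
proof -
  interpret A: group "A_grp G" by (rule group_A_grp)
  let ?cl = "pres_class (carrier G) (conj_relations G)"
  have "P (?cl w)" if "w \<in> gwords (carrier G)" for w
    using that
  proof (induction w)
    case Nil
    then show ?case using assms(2) by (simp add: A_grp_def one_presented_group)
  next
    case (Cons p w)
    obtain s b where p: "p = (s, b)" by (cases p)
    have b: "b \<in> carrier G" and w: "w \<in> gwords (carrier G)" and sb: "[(t, b)] \<in> gwords (carrier G)" for t
      using Cons.prems p by (auto simp: gwords_def)
    have y: "?cl w \<in> carrier (A_grp G)"
      using w by (simp add: A_grp_def carrier_presented_group)
    have split: "?cl (p # w) = ?cl [(s, b)] \<otimes>\<^bsub>A_grp G\<^esub> ?cl w"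
      using presented_group_mult[OF sb w, of "conj_relations G"] p by (simp add: A_grp_def)
    show ?case
    proof (cases s)
      case True
      then show ?thesis using gen[OF b y Cons.IH[OF w]] split by (simp add: e_gen_def)
    next
      case False
      have "?cl [(False, b)] \<otimes>\<^bsub>A_grp G\<^esub> e_gen G b = ?cl ([(False, b)] @ [(True, b)])"
        unfolding e_gen_def A_grp_def by (rule presented_group_mult[OF sb sb])
      also have "\<dots> = \<one>\<^bsub>A_grp G\<^esub>"
        using pres_cong.cancel[OF b, of "conj_relations G" False]
        by (simp add: A_grp_def one_presented_group pres_class_eq_iff gwords_Nil)
      finally have "inv\<^bsub>A_grp G\<^esub> (e_gen G b) = ?cl [(False, b)]"
        using sb by (intro A.inv_equality e_gen_closed b)
          (simp_all add: A_grp_def carrier_presented_group)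
      then show ?thesis using inv_gen[OF b y Cons.IH[OF w]] split False by simp
    qed
  qed
  then show ?thesis using assms(1) by (auto simp: A_grp_def carrier_presented_group)
qed

lemma e_gen_conjugation:
  assumes "group G" "x \<in> carrier (A_grp G)" "a \<in> carrier G"
  shows "e_gen G a \<otimes>\<^bsub>A_grp G\<^esub> x
    = x \<otimes>\<^bsub>A_grp G\<^esub> e_gen G (inv\<^bsub>G\<^esub> (A_proj G x) \<otimes>\<^bsub>G\<^esub> a \<otimes>\<^bsub>G\<^esub> A_proj G x)"
  using assms(2,3)
proof (induction arbitrary: a rule: A_grp_induct)
  interpret group G by fact
  interpret A: group "A_grp G" by (rule group_A_grp)
  interpret p: group_hom "A_grp G" G "A_proj G" by (rule group_hom_A_proj) fact
  case one
  then show ?case by (simp add: e_gen_closed)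
next
  interpret group G by fact
  interpret A: group "A_grp G" by (rule group_A_grp)
  interpret p: group_hom "A_grp G" G "A_proj G" by (rule group_hom_A_proj) fact
  case (gen b y)
  let ?a = "inv\<^bsub>G\<^esub> b \<otimes>\<^bsub>G\<^esub> a \<otimes>\<^bsub>G\<^esub> b"
  have "e_gen G a \<otimes>\<^bsub>A_grp G\<^esub> (e_gen G b \<otimes>\<^bsub>A_grp G\<^esub> y)
      = e_gen G b \<otimes>\<^bsub>A_grp G\<^esub> (e_gen G ?a \<otimes>\<^bsub>A_grp G\<^esub> y)"
    using e_gen_relation[OF assms(1), of a b] gen.hyps gen.prems
    by (simp add: e_gen_closed flip: A.m_assoc)
  also have "\<dots> = e_gen G b \<otimes>\<^bsub>A_grp G\<^esub>
      (y \<otimes>\<^bsub>A_grp G\<^esub> e_gen G (inv\<^bsub>G\<^esub> (A_proj G y) \<otimes>\<^bsub>G\<^esub> ?a \<otimes>\<^bsub>G\<^esub> A_proj G y))"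
    using gen by simp
  finally show ?case
    using gen.hyps gen.prems
    by (simp add: e_gen_closed A_proj_e_gen[OF assms(1)] inv_mult_group A.m_assoc m_assoc)
next
  interpret group G by fact
  interpret A: group "A_grp G" by (rule group_A_grp)
  interpret p: group_hom "A_grp G" G "A_proj G" by (rule group_hom_A_proj) fact
  case (inv_gen b y)
  let ?a = "b \<otimes>\<^bsub>G\<^esub> a \<otimes>\<^bsub>G\<^esub> inv\<^bsub>G\<^esub> b"
  have e: "e_gen G a \<in> carrier (A_grp G)" "e_gen G b \<in> carrier (A_grp G)"
    "e_gen G ?a \<in> carrier (A_grp G)"
    using inv_gen.hyps inv_gen.prems by (simp_all add: e_gen_closed)
  have "inv\<^bsub>G\<^esub> b \<otimes>\<^bsub>G\<^esub> ?a \<otimes>\<^bsub>G\<^esub> b = a"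
    using inv_gen.hyps inv_gen.prems by (simp add: m_assoc) (simp flip: m_assoc)
  then have "e_gen G ?a \<otimes>\<^bsub>A_grp G\<^esub> e_gen G b = e_gen G b \<otimes>\<^bsub>A_grp G\<^esub> e_gen G a"
    using e_gen_relation[OF assms(1), of ?a b] inv_gen.hyps inv_gen.prems by simp
  then have "e_gen G a \<otimes>\<^bsub>A_grp G\<^esub> inv\<^bsub>A_grp G\<^esub> (e_gen G b)
      = inv\<^bsub>A_grp G\<^esub> (e_gen G b) \<otimes>\<^bsub>A_grp G\<^esub> e_gen G ?a"
    using e by (metis A.inv_closed A.inv_solve_left A.inv_solve_right A.m_assoc A.m_closed)
  then have "e_gen G a \<otimes>\<^bsub>A_grp G\<^esub> (inv\<^bsub>A_grp G\<^esub> (e_gen G b) \<otimes>\<^bsub>A_grp G\<^esub> y)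
      = inv\<^bsub>A_grp G\<^esub> (e_gen G b) \<otimes>\<^bsub>A_grp G\<^esub> (e_gen G ?a \<otimes>\<^bsub>A_grp G\<^esub> y)"
    using e inv_gen.hyps by (simp flip: A.m_assoc)
  also have "\<dots> = inv\<^bsub>A_grp G\<^esub> (e_gen G b) \<otimes>\<^bsub>A_grp G\<^esub>
      (y \<otimes>\<^bsub>A_grp G\<^esub> e_gen G (inv\<^bsub>G\<^esub> (A_proj G y) \<otimes>\<^bsub>G\<^esub> ?a \<otimes>\<^bsub>G\<^esub> A_proj G y))"
    using inv_gen by simp
  finally show ?case
    using inv_gen.hyps inv_gen.prems e
    by (simp add: e_gen_closed A_proj_e_gen[OF assms(1)] inv_mult_group A.m_assoc m_assoc)
qed

theorem K_grp_central:
  assumes "group G" "k \<in> carrier (K_grp G)" "x \<in> carrier (A_grp G)"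
  shows "x \<otimes>\<^bsub>A_grp G\<^esub> k = k \<otimes>\<^bsub>A_grp G\<^esub> x"
  using assms(3)
proof (induction rule: A_grp_induct)
  interpret A: group "A_grp G" by (rule group_A_grp)
  have k: "k \<in> carrier (A_grp G)" using assms(2) by (simp add: K_grp_def kernel_def)
  case one
  then show ?case using k by simp
next
  interpret group G by fact
  interpret A: group "A_grp G" by (rule group_A_grp)
  have k: "k \<in> carrier (A_grp G)" "A_proj G k = \<one>\<^bsub>G\<^esub>"
    using assms(2) by (simp_all add: K_grp_def kernel_def)
  case (gen b y)
  have "e_gen G b \<otimes>\<^bsub>A_grp G\<^esub> k = k \<otimes>\<^bsub>A_grp G\<^esub> e_gen G b"
    using e_gen_conjugation[OF assms(1) k(1), of b] k gen.hyps by simp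
  then show ?case
    using gen e_gen_closed[of b G] k by (metis A.m_assoc)
next
  interpret group G by fact
  interpret A: group "A_grp G" by (rule group_A_grp)
  have k: "k \<in> carrier (A_grp G)" "A_proj G k = \<one>\<^bsub>G\<^esub>"
    using assms(2) by (simp_all add: K_grp_def kernel_def)
  case (inv_gen b y)
  have "e_gen G b \<otimes>\<^bsub>A_grp G\<^esub> k = k \<otimes>\<^bsub>A_grp G\<^esub> e_gen G b"
    using e_gen_conjugation[OF assms(1) k(1), of b] k inv_gen.hyps by simp
  then have "inv\<^bsub>A_grp G\<^esub> (e_gen G b) \<otimes>\<^bsub>A_grp G\<^esub> k = k \<otimes>\<^bsub>A_grp G\<^esub> inv\<^bsub>A_grp G\<^esub> (e_gen G b)"
    using e_gen_closed[OF inv_gen.hyps(1)] k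
    by (metis A.inv_closed A.inv_solve_left A.inv_solve_right A.m_assoc A.m_closed)
  then show ?case
    using inv_gen e_gen_closed[of b G] k by (metis A.m_assoc A.inv_closed)
qed

theorem comm_group_K_grp: "group G \<Longrightarrow> comm_group (K_grp G)"
  using K_grp_central[of G]
  by (intro group.group_comm_groupI group_K_grp) (auto simp: K_grp_def kernel_def)

end

theory Submission
  imports Defs
begin

text \<open>By definition \<open>e\<^sub>a e\<^sub>b = e\<^bsub>ab\<^esub> \<phi>(a,b)\<close> with \<open>\<phi>(a,b)\<close> central. Expanding
  \<open>e\<^sub>a e\<^sub>b e\<^sub>c\<close> in two ways gives the cocycle identity. Conjugation by \<open>e\<^sub>c\<close> maps \<open>e\<^sub>a\<close> to
  \<open>e\<^bsub>c\<^sup>-\<^sup>1ac\<^esub>\<close> and fixes the central elements, which gives equivariance. Finally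
  \<open>e\<^sub>a e\<^sub>b = e\<^sub>b e\<^bsub>b\<^sup>-\<^sup>1ab\<^esub>\<close> gives \<open>\<phi>(a,b) = \<phi>(b, b\<^sup>-\<^sup>1ab)\<close>, which is \<open>\<phi>(b,a)\<close> by equivariance
  under \<open>b\<close>.\<close>

text \<open>\<open>A_proj G\<close> sends e_(ab)^-1 e_a e_b to (ab)^-1 a b = 1. With
  \<open>K_grp_central\<close> this makes every value of \<open>phi\<close> central.\<close>

lemma phi_closed:
  assumes "group G" "a \<in> carrier G" "b \<in> carrier G"
  shows "phi G a b \<in> carrier (K_grp G)"
proof -
  interpret group G by fact
  interpret A: group "A_grp G" by (rule group_A_grp)
  interpret p: group_hom "A_grp G" G "A_proj G" by (rule group_hom_A_proj) fact
  show ?thesis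
    using assms
    by (simp add: K_grp_def kernel_def phi_def e_gen_closed A_proj_e_gen inv_mult_group m_assoc)
qed

lemma carrier_K_grp_subset: "k \<in> carrier (K_grp G) \<Longrightarrow> k \<in> carrier (A_grp G)"
  by (simp add: K_grp_def kernel_def)

text \<open>\<open>K_grp G\<close> differs from \<open>A_grp G\<close> only in its carrier; the
  rewriting moves products to \<open>A_grp G\<close>, where they can be mixed with
  generators.\<close>

lemma mult_K_grp [simp]: "x \<otimes>\<^bsub>K_grp G\<^esub> y = x \<otimes>\<^bsub>A_grp G\<^esub> y"
  by (simp add: K_grp_def)

lemma e_gen_mult:
  assumes "group G" "a \<in> carrier G" "b \<in> carrier G"
  shows "e_gen G a \<otimes>\<^bsub>A_grp G\<^esub> e_gen G b = e_gen G (a \<otimes>\<^bsub>G\<^esub> b) \<otimes>\<^bsub>A_grp G\<^esub> phi G a b"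
proof -
  interpret group G by fact
  interpret A: group "A_grp G" by (rule group_A_grp)
  show ?thesis
    using assms by (simp add: phi_def e_gen_closed flip: A.m_assoc)
qed

text \<open>The inverse-free form is what comparing the two bracketings of e_a e_b e_c yields: both
  sides are multiplied on the left by e_(abc), which is cancelled at the end.\<close>

lemma phi_cocycle:
  assumes "group G" "a \<in> carrier G" "b \<in> carrier G" "c \<in> carrier G"
  shows "phi G a (b \<otimes>\<^bsub>G\<^esub> c) \<otimes>\<^bsub>K_grp G\<^esub> phi G b c
    = phi G (a \<otimes>\<^bsub>G\<^esub> b) c \<otimes>\<^bsub>K_grp G\<^esub> phi G a b"
proof -
  interpret group G by fact
  interpret A: group "A_grp G" by (rule group_A_grp)
  note ph = phi_closed[OF assms(1), THEN carrier_K_grp_subset]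
  let ?e = "e_gen G" and ?abc = "a \<otimes>\<^bsub>G\<^esub> b \<otimes>\<^bsub>G\<^esub> c"
  have "?e ?abc \<otimes>\<^bsub>A_grp G\<^esub> (phi G a (b \<otimes>\<^bsub>G\<^esub> c) \<otimes>\<^bsub>A_grp G\<^esub> phi G b c)
      = ?e a \<otimes>\<^bsub>A_grp G\<^esub> ?e (b \<otimes>\<^bsub>G\<^esub> c) \<otimes>\<^bsub>A_grp G\<^esub> phi G b c"
    using assms by (simp add: e_gen_mult e_gen_closed ph A.m_assoc m_assoc)
  also have "\<dots> = ?e a \<otimes>\<^bsub>A_grp G\<^esub> ?e b \<otimes>\<^bsub>A_grp G\<^esub> ?e c"
    using assms e_gen_mult[OF assms(1,3,4)] by (simp add: e_gen_closed ph A.m_assoc)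
  also have "\<dots> = ?e (a \<otimes>\<^bsub>G\<^esub> b) \<otimes>\<^bsub>A_grp G\<^esub> (phi G a b \<otimes>\<^bsub>A_grp G\<^esub> ?e c)"
    using assms e_gen_mult[OF assms(1-3)] by (simp add: e_gen_closed ph A.m_assoc)
  \<comment> \<open>Centrality moves \<open>phi G a b\<close> past e_c, so that e_(ab) and e_c
    become adjacent and can be merged.\<close>
  also have "\<dots> = ?e (a \<otimes>\<^bsub>G\<^esub> b) \<otimes>\<^bsub>A_grp G\<^esub> ?e c \<otimes>\<^bsub>A_grp G\<^esub> phi G a b"
    using assms K_grp_central[OF assms(1) phi_closed[OF assms(1-3)], of "?e c"]
    by (simp add: e_gen_closed ph A.m_assoc)
  also have "\<dots> = ?e ?abc \<otimes>\<^bsub>A_grp G\<^esub> (phi G (a \<otimes>\<^bsub>G\<^esub> b) c \<otimes>\<^bsub>A_grp G\<^esub> phi G a b)"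
    using assms e_gen_mult[OF assms(1) _ assms(4), of "a \<otimes>\<^bsub>G\<^esub> b"]
    by (simp add: e_gen_closed ph A.m_assoc)
  finally show ?thesis
    using assms by (simp add: e_gen_closed ph)
qed

lemma phi_one:
  assumes "group G" "a \<in> carrier G"
  shows "phi G a \<one>\<^bsub>G\<^esub> = e_gen G \<one>\<^bsub>G\<^esub>"
proof -
  interpret group G by fact
  interpret A: group "A_grp G" by (rule group_A_grp)
  show ?thesis
    using assms by (simp add: phi_def e_gen_closed)
qed

text \<open>The relation e_x e_c = e_c e_(c^-1 x c) lets e_c travel through a product, removing or
  adding the conjugation. Both sides are compared after multiplication by e_c e_(c^-1 ab c).\<close>

lemma phi_equivariant:
  assumes "group G" "a \<in> carrier G" "b \<in> carrier G" "c \<in> carrier G"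
  shows "phi G (inv\<^bsub>G\<^esub> c \<otimes>\<^bsub>G\<^esub> a \<otimes>\<^bsub>G\<^esub> c) (inv\<^bsub>G\<^esub> c \<otimes>\<^bsub>G\<^esub> b \<otimes>\<^bsub>G\<^esub> c) = phi G a b"
proof -
  interpret group G by fact
  interpret A: group "A_grp G" by (rule group_A_grp)
  let ?e = "e_gen G"
  let ?c = "\<lambda>x. inv\<^bsub>G\<^esub> c \<otimes>\<^bsub>G\<^esub> x \<otimes>\<^bsub>G\<^esub> c"
  have cl: "?c x \<in> carrier G" if "x \<in> carrier G" for x
    using that assms by simp
  have cmult: "?c a \<otimes>\<^bsub>G\<^esub> ?c b = ?c (a \<otimes>\<^bsub>G\<^esub> b)"
    using assms by (simp add: m_assoc) (simp flip: m_assoc)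
  note ph = phi_closed[OF assms(1), THEN carrier_K_grp_subset]
  note rel = e_gen_relation[OF assms(1) _ assms(4)]
  have "?e c \<otimes>\<^bsub>A_grp G\<^esub> (?e (?c (a \<otimes>\<^bsub>G\<^esub> b)) \<otimes>\<^bsub>A_grp G\<^esub> phi G (?c a) (?c b))
      = ?e c \<otimes>\<^bsub>A_grp G\<^esub> ?e (?c a) \<otimes>\<^bsub>A_grp G\<^esub> ?e (?c b)"
    using e_gen_mult[OF assms(1) cl cl, of a b] assms cl[of a] cl[of b] unfolding cmult
    by (simp add: e_gen_closed ph A.m_assoc)
  \<comment> \<open>From here e_c passes to the right over both conjugated generators, leaving e_a
    e_b e_c.\<close>
  also have "\<dots> = ?e a \<otimes>\<^bsub>A_grp G\<^esub> (?e c \<otimes>\<^bsub>A_grp G\<^esub> ?e (?c b))"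
    using rel[of a] assms by (simp add: e_gen_closed flip: A.m_assoc)
  also have "\<dots> = ?e a \<otimes>\<^bsub>A_grp G\<^esub> ?e b \<otimes>\<^bsub>A_grp G\<^esub> ?e c"
    using rel[of b] assms by (simp add: e_gen_closed A.m_assoc)
  \<comment> \<open>Once e_a e_b is merged, the central factor is put behind e_c, so that e_c can
    return to the left over e_(ab).\<close>
  also have "\<dots> = ?e (a \<otimes>\<^bsub>G\<^esub> b) \<otimes>\<^bsub>A_grp G\<^esub> (?e c \<otimes>\<^bsub>A_grp G\<^esub> phi G a b)"
    using assms K_grp_central[OF assms(1) phi_closed[OF assms(1-3)], of "?e c"]
      e_gen_mult[OF assms(1-3)]
    by (simp add: e_gen_closed ph A.m_assoc)
  also have "\<dots> = ?e c \<otimes>\<^bsub>A_grp G\<^esub> (?e (?c (a \<otimes>\<^bsub>G\<^esub> b)) \<otimes>\<^bsub>A_grp G\<^esub> phi G a b)"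
    using rel[of "a \<otimes>\<^bsub>G\<^esub> b"] assms cl[of "a \<otimes>\<^bsub>G\<^esub> b"]
    by (simp add: e_gen_closed ph flip: A.m_assoc)
  finally show ?thesis
    using assms by (simp add: e_gen_closed ph)
qed

lemma phi_commute:
  assumes "group G" "a \<in> carrier G" "b \<in> carrier G"
  shows "phi G a b = phi G b a"
proof -
  interpret group G by fact
  interpret A: group "A_grp G" by (rule group_A_grp)
  let ?a = "inv\<^bsub>G\<^esub> b \<otimes>\<^bsub>G\<^esub> a \<otimes>\<^bsub>G\<^esub> b"
  \<comment> \<open>Both sides of the relation e_a e_b = e_b e_(b^-1 ab) thus yield the same
    generator e_(ab), which cancels.\<close>
  have eq: "b \<otimes>\<^bsub>G\<^esub> ?a = a \<otimes>\<^bsub>G\<^esub> b"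
    using assms by (simp flip: m_assoc)
  note ph = phi_closed[OF assms(1), THEN carrier_K_grp_subset]
  have "e_gen G (a \<otimes>\<^bsub>G\<^esub> b) \<otimes>\<^bsub>A_grp G\<^esub> phi G a b
      = e_gen G (a \<otimes>\<^bsub>G\<^esub> b) \<otimes>\<^bsub>A_grp G\<^esub> phi G b ?a"
    using e_gen_relation[OF assms] e_gen_mult[OF assms] e_gen_mult[OF assms(1,3), of ?a] assms eq
    by simp
  then have "phi G a b = phi G b ?a"
    using assms by (simp add: e_gen_closed ph)
  \<comment> \<open>Equivariance is applied to the pair (b, a) with c = b; conjugation by b fixes
    b.\<close>
  also have "\<dots> = phi G b a"
    using phi_equivariant[OF assms(1,3,2,3)] assms by simp
  finally show ?thesis .
qed

theorem proposition5p1: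
  fixes G :: "('a, 'm) monoid_scheme" (structure)
  assumes "group G"
  shows "(\<forall>a\<in>carrier G. \<forall>b\<in>carrier G. phi G a b \<in> carrier (K_grp G))
    \<and> (\<forall>a\<in>carrier G. \<forall>b\<in>carrier G. \<forall>c\<in>carrier G.
         phi G b c \<otimes>\<^bsub>K_grp G\<^esub> inv\<^bsub>K_grp G\<^esub> (phi G (a \<otimes> b) c)
           \<otimes>\<^bsub>K_grp G\<^esub> phi G a (b \<otimes> c) \<otimes>\<^bsub>K_grp G\<^esub> inv\<^bsub>K_grp G\<^esub> (phi G a b) = \<one>\<^bsub>K_grp G\<^esub>)
    \<and> (\<forall>a\<in>carrier G. phi G a \<one> = e_gen G \<one>)
    \<and> (\<forall>a\<in>carrier G. \<forall>b\<in>carrier G. \<forall>c\<in>carrier G.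
         phi G (inv c \<otimes> a \<otimes> c) (inv c \<otimes> b \<otimes> c) = phi G a b)
    \<and> (\<forall>a\<in>carrier G. \<forall>b\<in>carrier G. phi G a b = phi G b a)"
proof -
  interpret K: comm_group "K_grp G"
    using assms by (rule comm_group_K_grp)
  \<comment> \<open>Additively, p - q + r - s = 0 follows from r + p = q + s, the shape of
    \<open>phi_cocycle\<close>.\<close>
  have cocycle: "p \<otimes>\<^bsub>K_grp G\<^esub> inv\<^bsub>K_grp G\<^esub> q \<otimes>\<^bsub>K_grp G\<^esub> r \<otimes>\<^bsub>K_grp G\<^esub> inv\<^bsub>K_grp G\<^esub> s = \<one>\<^bsub>K_grp G\<^esub>"
    if "r \<otimes>\<^bsub>K_grp G\<^esub> p = q \<otimes>\<^bsub>K_grp G\<^esub> s"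
      and "p \<in> carrier (K_grp G)" "q \<in> carrier (K_grp G)"
        "r \<in> carrier (K_grp G)" "s \<in> carrier (K_grp G)" for p q r s
  proof -
    have "p \<otimes>\<^bsub>K_grp G\<^esub> inv\<^bsub>K_grp G\<^esub> q \<otimes>\<^bsub>K_grp G\<^esub> r \<otimes>\<^bsub>K_grp G\<^esub> inv\<^bsub>K_grp G\<^esub> s
        = (r \<otimes>\<^bsub>K_grp G\<^esub> p) \<otimes>\<^bsub>K_grp G\<^esub> inv\<^bsub>K_grp G\<^esub> (q \<otimes>\<^bsub>K_grp G\<^esub> s)"
      \<comment> \<open>\<open>mult_K_grp\<close> would rewrite the products into
        \<open>A_grp G\<close>, where the commutative laws of \<open>K\<close> no longer
        match.\<close>
      using that(2-) by (simp add: K.inv_mult K.m_ac del: mult_K_grp)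
    then show ?thesis
      using that by (simp del: mult_K_grp)
  qed
  interpret group G by fact
  show ?thesis
    using assms
    by (intro conjI ballI cocycle phi_cocycle phi_closed phi_one phi_equivariant phi_commute)
      simp_all
qed

end
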